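(* Let $T>0$ and let $B\in L_2[0,T]$ be real-valued. The solution $f_T$ of the minimization problem \[ \mathcal{E}_T(f):=\int_0^T\left[f'(t)^2+|f(t)-B(t)|^2\right]dt\searrow\min,\qquad f\in\mathbb{W}_2^1[0,T], \] is given for $0\le t\le T$ by \[ f_T(t)=-\int_0^t B(s)\sinh(t-s)\,ds+\frac{\int_0^T B(s)\cosh(T-s)\,ds}{e^T-e^{-T}}\left(e^t+e^{-t}\right). \] Moreover, for $0<t<T$ we have \[ f_T'(t)=-\int_0^t B(s)\cosh(t-s)\,ds+\frac{\int_0^T B(s)\cosh(T-s)\,ds}{e^T-e^{-T}}\left(e^t-e^{-t}\right). \]
   Context: $\mathbb{W}_2^1[0,T]$ denotes the Sobolev space of all absolutely continuous functions $f:[0,T]\to\mathbb{R}$ having square integrable derivative on $[0,T]$ (no boundary conditions are imposed). "Solution" of the problem means a minimizer of $\mathcal{E}_T$ over $\mathbb{W}_2^1[0,T]$. *)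

theory Defs
  imports "HOL-Analysis.Analysis"
begin

text \<open>Absolute continuity on \<open>[a, b]\<close> in the epsilon-delta sense. A pair \<open>(u, v)\<close> stands for the
  interval with end points \<open>u \<le> v\<close>; only the open intervals have to be disjoint.\<close>

definition absolutely_continuous_on_interval :: "real \<Rightarrow> real \<Rightarrow> (real \<Rightarrow> real) \<Rightarrow> bool" where
  "absolutely_continuous_on_interval a b f \<longleftrightarrow>
    (\<forall>\<epsilon>>0. \<exists>\<delta>>0. \<forall>I :: (real \<times> real) set.
      finite I \<longrightarrow>
      (\<forall>(u, v) \<in> I. a \<le> u \<and> u \<le> v \<and> v \<le> b) \<longrightarrow>
      disjoint_family_on (\<lambda>(u, v). {u<..<v}) I \<longrightarrow>
      (\<Sum>(u, v) \<in> I. v - u) < \<delta> \<longrightarrow>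
      (\<Sum>(u, v) \<in> I. \<bar>f v - f u\<bar>) < \<epsilon>)"

definition square_integrable_on :: "real set \<Rightarrow> (real \<Rightarrow> real) \<Rightarrow> bool" where
  "square_integrable_on S f \<longleftrightarrow>
    f \<in> borel_measurable (lebesgue_on S) \<and> integrable (lebesgue_on S) (\<lambda>t. (f t)\<^sup>2)"

text \<open>Elements of the Sobolev space are represented by total functions; values outside \<open>[0, T]\<close>
  are irrelevant, since they influence \<open>deriv f\<close> on \<open>[0, T]\<close> at most at the two end points.
  That the derivative exists almost everywhere follows from absolute continuity (Lebesgue); it is
  spelled out because \<open>deriv f t\<close> is unspecified where \<open>f\<close> is not differentiable.\<close>

definition sobolev_W21 :: "real \<Rightarrow> (real \<Rightarrow> real) set" where
  "sobolev_W21 T = {f. absolutely_continuous_on_interval 0 T f \<and>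
     (AE t in lebesgue_on {0..T}. f differentiable (at t)) \<and>
     square_integrable_on {0..T} (deriv f)}"

definition energy :: "real \<Rightarrow> (real \<Rightarrow> real) \<Rightarrow> (real \<Rightarrow> real) \<Rightarrow> real" where
  "energy T B f = (LINT t|lebesgue_on {0..T}. (deriv f t)\<^sup>2 + \<bar>f t - B t\<bar>\<^sup>2)"

definition is_solution :: "real \<Rightarrow> (real \<Rightarrow> real) \<Rightarrow> (real \<Rightarrow> real) \<Rightarrow> bool" where
  "is_solution T B f \<longleftrightarrow> f \<in> sobolev_W21 T \<and> (\<forall>g \<in> sobolev_W21 T. energy T B f \<le> energy T B g)"

end

theory Submission
  imports Defs
begin

text \<open>
  The functional is a strictly convex quadratic, so completing the square settles everything once
  a critical point is known. Its Euler--Lagrange equation is \<open>f'' = f - B\<close>, and since the end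
  values of \<open>f\<close> are free, the natural boundary conditions are \<open>f' 0 = 0\<close> and \<open>f' T = 0\<close>.
  Variation of constants gives the solutions of the equation with \<open>f' 0 = 0\<close> as
  \<open>f t = - (LINT s|lebesgue_on {0..t}. B s * sinh (t - s)) + 2 * c * cosh t\<close>, and \<open>f' T = 0\<close>
  forces the value of \<open>c\<close> in the theorem (\<open>minimizer_euler_lagrange\<close>). Write \<open>m\<close> for this solution
  and let \<open>u\<close> be any element of the Sobolev space, \<open>h = u - m\<close>. In the expansion of the energy of
  \<open>m + h\<close> the cross term is twice the integral of \<open>h' * m' + h * (m - B) = (h * m')'\<close>, which vanishes by
  the boundary conditions. So the energy of \<open>u\<close> exceeds that of \<open>m\<close> by exactly the integral of
  \<open>h'\<^sup>2 + h\<^sup>2\<close> (\<open>energy_eq_energy_minimizer_plus\<close>), which is nonnegative and, \<open>h\<close> being continuous, zero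
  only for \<open>h = 0\<close>.

  Two analytic facts are needed because \<open>B\<close> is only square integrable. First, an absolutely
  continuous function is the integral of its derivative
  (\<open>absolutely_continuous_has_integral_derivative\<close>). With differentiability almost everywhere given,
  this is direct for the gauge integral: a gauge may be chosen freely at the exceptional points, so
  that the intervals tagged there lie in an open set of tiny measure, and absolute continuity makes
  the increments over them small. Second, products of absolutely continuous functions can be
  integrated by parts. To avoid differentiating indefinite integrals almost everywhere, both
  factors are treated as primitives in the sense of \<open>primitive_on\<close>, an integral equation; the
  product rule \<open>primitive_on_mult\<close> is then Fubini's theorem on the two triangles of a square. The
  same product rule, applied to the addition theorems for \<open>sinh\<close> and \<open>cosh\<close>, verifies the
  Euler--Lagrange equation for \<open>m\<close>.
\<close>

section \<open>Absolute continuity and the fundamental theorem of calculus\<close>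

lemma absolutely_continuous_on_interval_Lipschitz:
  assumes lip: "\<And>u v. \<lbrakk>a \<le> u; u \<le> v; v \<le> b\<rbrakk> \<Longrightarrow> \<bar>f v - f u\<bar> \<le> L * (v - u)" and "L > 0"
  shows "absolutely_continuous_on_interval a b f"
  unfolding absolutely_continuous_on_interval_def
proof (intro allI impI)
  fix \<epsilon> :: real assume "\<epsilon> > 0"
  show "\<exists>\<delta>>0. \<forall>I :: (real \<times> real) set. finite I \<longrightarrow>
      (\<forall>(u, v)\<in>I. a \<le> u \<and> u \<le> v \<and> v \<le> b) \<longrightarrow>
      disjoint_family_on (\<lambda>(u, v). {u<..<v}) I \<longrightarrow> (\<Sum>(u, v)\<in>I. v - u) < \<delta> \<longrightarrow>
      (\<Sum>(u, v)\<in>I. \<bar>f v - f u\<bar>) < \<epsilon>"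
  proof (rule exI[of _ "\<epsilon> / L"], intro conjI allI impI)
    fix I :: "(real \<times> real) set"
    assume I: "\<forall>(u, v)\<in>I. a \<le> u \<and> u \<le> v \<and> v \<le> b" "(\<Sum>(u, v)\<in>I. v - u) < \<epsilon> / L"
    have "(\<Sum>(u, v)\<in>I. \<bar>f v - f u\<bar>) \<le> (\<Sum>(u, v)\<in>I. L * (v - u))"
      using I(1) lip by (intro sum_mono) auto
    also have "\<dots> = L * (\<Sum>(u, v)\<in>I. v - u)"
      by (simp add: sum_distrib_left split_beta)
    also have "\<dots> < \<epsilon>"
      using I(2) \<open>L > 0\<close> by (simp add: field_simps)
    finally show "(\<Sum>(u, v)\<in>I. \<bar>f v - f u\<bar>) < \<epsilon>" .
  qed (use \<open>\<epsilon> > 0\<close> \<open>L > 0\<close> in simp)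
qed

lemma absolutely_continuous_on_subinterval:
  assumes ac: "absolutely_continuous_on_interval a b f" and "t \<le> b"
  shows "absolutely_continuous_on_interval a t f"
  unfolding absolutely_continuous_on_interval_def
proof (intro allI impI)
  fix \<epsilon> :: real assume "\<epsilon> > 0"
  then obtain \<delta> where "\<delta> > 0" and \<delta>: "\<forall>I :: (real \<times> real) set. finite I \<longrightarrow>
      (\<forall>(u, v)\<in>I. a \<le> u \<and> u \<le> v \<and> v \<le> b) \<longrightarrow>
      disjoint_family_on (\<lambda>(u, v). {u<..<v}) I \<longrightarrow> (\<Sum>(u, v)\<in>I. v - u) < \<delta> \<longrightarrow>
      (\<Sum>(u, v)\<in>I. \<bar>f v - f u\<bar>) < \<epsilon>"
    by (rule ac[unfolded absolutely_continuous_on_interval_def, THEN spec, THEN mp, THEN exE])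
       (elim conjE, rule that)
  show "\<exists>\<delta>>0. \<forall>I :: (real \<times> real) set. finite I \<longrightarrow>
      (\<forall>(u, v)\<in>I. a \<le> u \<and> u \<le> v \<and> v \<le> t) \<longrightarrow>
      disjoint_family_on (\<lambda>(u, v). {u<..<v}) I \<longrightarrow> (\<Sum>(u, v)\<in>I. v - u) < \<delta> \<longrightarrow>
      (\<Sum>(u, v)\<in>I. \<bar>f v - f u\<bar>) < \<epsilon>"
  proof (rule exI[of _ \<delta>], intro conjI allI impI)
    fix I :: "(real \<times> real) set"
    assume I: "finite I" "\<forall>(u, v)\<in>I. a \<le> u \<and> u \<le> v \<and> v \<le> t"
      "disjoint_family_on (\<lambda>(u, v). {u<..<v}) I" "(\<Sum>(u, v)\<in>I. v - u) < \<delta>"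
    have "\<forall>(u, v)\<in>I. a \<le> u \<and> u \<le> v \<and> v \<le> b"
      using I(2) \<open>t \<le> b\<close> by fastforce
    then show "(\<Sum>(u, v)\<in>I. \<bar>f v - f u\<bar>) < \<epsilon>"
      using \<delta> I(1,3,4) by blast
  qed (rule \<open>\<delta> > 0\<close>)
qed

text \<open>Transfers absolute continuity from sets of end-point pairs to tagged divisions. The intervals of a
  tagged division need not yield distinct pairs, but two entries with the same interval share
  its interior, so the interval is degenerate and contributes nothing to either sum.\<close>

lemma sum_increments_over_division_less:
  fixes f :: "real \<Rightarrow> real"
  assumes ac: "\<forall>I :: (real \<times> real) set. finite I \<longrightarrow> (\<forall>(u, v)\<in>I. a \<le> u \<and> u \<le> v \<and> v \<le> b) \<longrightarrow>
      disjoint_family_on (\<lambda>(u, v). {u<..<v}) I \<longrightarrow> (\<Sum>(u, v)\<in>I. v - u) < \<delta> \<longrightarrow>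
      (\<Sum>(u, v)\<in>I. \<bar>f v - f u\<bar>) < \<epsilon>"
    and p: "p tagged_partial_division_of {a..b}"
    and U: "U \<in> lmeasurable" "measure lebesgue U < \<delta>" "\<And>x K. (x, K) \<in> p \<Longrightarrow> K \<subseteq> U"
  shows "(\<Sum>(x, K)\<in>p. \<bar>f (Sup K) - f (Inf K)\<bar>) < \<epsilon>"
proof -
  note pD = tagged_partial_division_ofD[OF p]
  define \<phi> where "\<phi> = (\<lambda>(x :: real, K :: real set). (Inf K, Sup K))"
  have interval: "K = {Inf K..Sup K}" "Inf K \<le> Sup K" "a \<le> Inf K" "Sup K \<le> b"
    if xK: "(x, K) \<in> p" for x K
  proof -
    obtain u v where K: "K = {u..v}"
      using pD(4)[OF xK] by auto
    then have "u \<le> v" using pD(2)[OF xK] by auto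
    then show "K = {Inf K..Sup K}" "Inf K \<le> Sup K" "a \<le> Inf K" "Sup K \<le> b"
      using K pD(3)[OF xK] by auto
  qed
  have interior: "interior K = {Inf K<..<Sup K}" if "(x, K) \<in> p" for x K
    using interval(1)[OF that] interior_atLeastAtMost_real by metis
  have repeated: "Inf K = Sup K" if "(x, K) \<in> p" "(y, L) \<in> p" "(x, K) \<noteq> (y, L)"
      "\<phi> (x, K) = \<phi> (y, L)" for x K y L
  proof -
    have "K = L"
      using interval(1)[OF that(1)] interval(1)[OF that(2)] that(4) by (simp add: \<phi>_def)
    then have "{Inf K<..<Sup K} = {}"
      using pD(5)[OF that(1-3)] interior[OF that(1)] by auto
    then show ?thesis using interval(2)[OF that(1)] by simp
  qed
  have reindex: "(\<Sum>(u, v)\<in>\<phi> ` p. g u v) = (\<Sum>(x, K)\<in>p. g (Inf K) (Sup K))"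
    if "\<And>u. g u u = 0" for g :: "real \<Rightarrow> real \<Rightarrow> real"
  proof -
    have "(\<Sum>(u, v)\<in>\<phi> ` p. g u v) = (\<Sum>z\<in>p. (\<lambda>(u, v). g u v) (\<phi> z))"
      unfolding o_def[symmetric]
    proof (rule sum.reindex_nontrivial[OF pD(1)])
      fix z w assume "z \<in> p" "w \<in> p" "z \<noteq> w" "\<phi> z = \<phi> w"
      then have "Inf (snd z) = Sup (snd z)"
        using repeated[of "fst z" "snd z" "fst w" "snd w"] by auto
      then show "(\<lambda>(u, v). g u v) (\<phi> z) = 0"
        by (simp add: \<phi>_def split_beta that)
    qed
    then show ?thesis by (simp add: \<phi>_def split_beta)
  qed
  have "(\<Sum>(u, v)\<in>\<phi> ` p. v - u) = (\<Sum>(x, K)\<in>p. Sup K - Inf K)"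
    by (rule reindex) simp
  also have "\<dots> = (\<Sum>(x, K)\<in>p. measure lebesgue K)"
  proof (rule sum.cong[OF refl], clarsimp)
    fix x K assume xK: "(x, K) \<in> p"
    show "Sup K - Inf K = measure lebesgue K"
      using interval(2)[OF xK] by (subst (3) interval(1)[OF xK]) simp
  qed
  also have "\<dots> = (\<Sum>K\<in>snd ` p. measure lebesgue K)"
    by (rule sum.over_tagged_division_lemma[OF tagged_partial_division_of_Union_self[OF p]])
       (simp add: content_eq_0_interior)
  also have "\<dots> = measure lebesgue (\<Union> (snd ` p))"
    by (rule content_division[OF partial_division_of_tagged_division[OF p]])
  also have "\<dots> \<le> measure lebesgue U"
    using U(1,3) lmeasurable_division[OF partial_division_of_tagged_division[OF p]]
    by (intro measure_mono_fmeasurable) fastforce+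
  finally have small: "(\<Sum>(u, v)\<in>\<phi> ` p. v - u) < \<delta>"
    using U(2) by simp
  have disjoint: "disjoint_family_on (\<lambda>(u, v). {u<..<v}) (\<phi> ` p)"
    unfolding disjoint_family_on_def
  proof (intro ballI impI)
    fix m n assume mn: "m \<in> \<phi> ` p" "n \<in> \<phi> ` p" "m \<noteq> n"
    then obtain x K y L where xK: "(x, K) \<in> p" "m = \<phi> (x, K)" and yL: "(y, L) \<in> p" "n = \<phi> (y, L)"
      by auto
    have "interior K \<inter> interior L = {}"
      using pD(5)[OF xK(1) yL(1)] mn(3) xK(2) yL(2) by auto
    then show "(case m of (u, v) \<Rightarrow> {u<..<v}) \<inter> (case n of (u, v) \<Rightarrow> {u<..<v}) = {}"
      using interior[OF xK(1)] interior[OF yL(1)] xK(2) yL(2) by (simp add: \<phi>_def)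
  qed
  have "finite (\<phi> ` p)" using pD(1) by simp
  moreover have "\<forall>(u, v)\<in>\<phi> ` p. a \<le> u \<and> u \<le> v \<and> v \<le> b"
    using interval(2-4) by (auto simp: \<phi>_def)
  ultimately have "(\<Sum>(u, v)\<in>\<phi> ` p. \<bar>f v - f u\<bar>) < \<epsilon>"
    using ac disjoint small by blast
  then show ?thesis
    by (subst (asm) reindex) simp_all
qed

text \<open>The form in which a derivative controls an interval tagged at \<open>x\<close>. Comparing both end points with
  \<open>x\<close> costs \<open>e * (x - u)\<close> and \<open>e * (v - x)\<close>; as \<open>x\<close> lies between them, these add up to
  \<open>e * (v - u)\<close>.\<close>

lemma deriv_straddle:
  fixes f :: "real \<Rightarrow> real"
  assumes "(f has_real_derivative D) (at x within S)" "e > 0"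
  obtains d where "d > 0" "\<And>u v. \<lbrakk>u \<in> S; v \<in> S; u \<le> x; x \<le> v; \<bar>u - x\<bar> < d; \<bar>v - x\<bar> < d\<rbrakk> \<Longrightarrow>
      \<bar>(v - u) * D - (f v - f u)\<bar> \<le> e * (v - u)"
proof -
  obtain d where d: "d > 0"
    "\<And>y. y \<in> S \<Longrightarrow> \<bar>y - x\<bar> < d \<Longrightarrow> \<bar>f y - f x - D * (y - x)\<bar> \<le> e * \<bar>y - x\<bar>"
    using assms unfolding has_field_derivative_def has_derivative_within_alt by auto
  have "\<bar>(v - u) * D - (f v - f u)\<bar> \<le> e * (v - u)"
    if "u \<in> S" "v \<in> S" "u \<le> x" "x \<le> v" "\<bar>u - x\<bar> < d" "\<bar>v - x\<bar> < d" for u v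
  proof -
    have "(v - u) * D - (f v - f u) = (f u - f x - D * (u - x)) - (f v - f x - D * (v - x))"
      by (simp add: algebra_simps)
    also have "\<bar>\<dots>\<bar> \<le> e * \<bar>u - x\<bar> + e * \<bar>v - x\<bar>"
      using d(2)[of u] d(2)[of v] that by linarith
    also have "\<dots> = e * (v - u)"
      using that by (simp add: algebra_simps)
    finally show ?thesis .
  qed
  with d(1) that show thesis by blast
qed

text \<open>The error of a fine tagged sum splits according to whether the tag lies in \<open>N\<close>. Tags outside \<open>N\<close>
  are controlled by the derivative, as in the classical theorem. Intervals tagged in \<open>N\<close> are
  forced by the gauge into an open set \<open>U\<close> around \<open>N\<close> of measure below the \<open>\<delta>\<close> of absolute
  continuity, so their increments are small in total; setting the integrand to zero on \<open>N\<close> removes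
  their other contribution.\<close>

theorem absolutely_continuous_has_integral_derivative:
  fixes f :: "real \<Rightarrow> real"
  assumes "a \<le> b" and ac: "absolutely_continuous_on_interval a b f"
    and N: "negligible N"
    and deriv: "\<And>x. x \<in> {a..b} - N \<Longrightarrow> (f has_real_derivative f' x) (at x within {a..b})"
  shows "(f' has_integral (f b - f a)) {a..b}"
proof -
  define g where "g x = (if x \<in> N then 0 else f' x)" for x
  have "(g has_integral (f b - f a)) (cbox a b)"
    unfolding has_integral
  proof (intro allI impI)
    fix e :: real assume "e > 0"
    \<comment> \<open>The slack \<open>+ 1\<close> keeps the denominator positive when \<open>a = b\<close>.\<close>
    define r where "r = e / (2 * (b - a + 1))"
    have r: "r > 0" "r * (b - a) < e / 2"
      using \<open>e > 0\<close> \<open>a \<le> b\<close> by (auto simp: r_def field_simps)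
    have "e / 2 > 0" using \<open>e > 0\<close> by simp
    then obtain \<delta> where "\<delta> > 0" and \<delta>: "\<forall>I :: (real \<times> real) set. finite I \<longrightarrow>
        (\<forall>(u, v)\<in>I. a \<le> u \<and> u \<le> v \<and> v \<le> b) \<longrightarrow>
        disjoint_family_on (\<lambda>(u, v). {u<..<v}) I \<longrightarrow> (\<Sum>(u, v)\<in>I. v - u) < \<delta> \<longrightarrow>
        (\<Sum>(u, v)\<in>I. \<bar>f v - f u\<bar>) < e / 2"
      by (rule ac[unfolded absolutely_continuous_on_interval_def, THEN spec, THEN mp, THEN exE])
         (elim conjE, rule that)
    obtain U where U: "open U" "N \<subseteq> U" "U \<in> lmeasurable" "measure lebesgue U < \<delta>"
    proof -
      have "N \<in> sets lebesgue" using N by (simp add: negligible_imp_sets)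
      then obtain U where U: "open U" "N \<subseteq> U" "U - N \<in> lmeasurable" "emeasure lebesgue (U - N) < ennreal \<delta>"
        using sets_lebesgue_outer_open \<open>\<delta> > 0\<close> by metis
      have "U = (U - N) \<union> N" using U(2) by auto
      then have "U \<in> lmeasurable" "measure lebesgue U = measure lebesgue (U - N)"
        using U(3) N negligible_imp_measurable measure_Un_null_set[of "U - N" lebesgue N]
        by (metis fmeasurable.Un, metis fmeasurableD negligible_iff_null_sets)
      moreover have "measure lebesgue (U - N) < \<delta>"
        using U(4) \<open>\<delta> > 0\<close> by (simp add: emeasure_eq_measure2[OF U(3)] ennreal_less_iff)
      ultimately show thesis using that U(1,2) by auto
    qed
    have "\<exists>d>0. x \<in> {a..b} - N \<longrightarrow> (\<forall>u\<in>{a..b}. \<forall>v\<in>{a..b}. u \<le> x \<longrightarrow> x \<le> v \<longrightarrow> \<bar>u - x\<bar> < d \<longrightarrow> \<bar>v - x\<bar> < d \<longrightarrow>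
        \<bar>(v - u) * f' x - (f v - f u)\<bar> \<le> r * (v - u))" for x
    proof (cases "x \<in> {a..b} - N")
      case True
      show ?thesis
        by (rule deriv_straddle[OF deriv[OF True] r(1)]) blast
    qed (auto intro: exI[of _ 1])
    then obtain d where d: "\<And>x. d x > 0" "\<And>x u v. \<lbrakk>x \<in> {a..b} - N; u \<in> {a..b}; v \<in> {a..b}; u \<le> x; x \<le> v; \<bar>u - x\<bar> < d x; \<bar>v - x\<bar> < d x\<rbrakk> \<Longrightarrow>
        \<bar>(v - u) * f' x - (f v - f u)\<bar> \<le> r * (v - u)"
      by metis
    define \<gamma> where "\<gamma> x = (if x \<in> N then U else ball x (d x))" for x
    have "gauge \<gamma>"
      using U(1,2) d(1) by (auto simp: gauge_def \<gamma>_def)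
    moreover have "norm ((\<Sum>(x, K)\<in>p. measure lborel K *\<^sub>R g x) - (f b - f a)) < e"
      if p: "p tagged_division_of cbox a b" and fine: "\<gamma> fine p" for p
    proof -
      have p': "p tagged_division_of {a..b}" using p by simp
      note pD = tagged_division_ofD[OF p']
      define q where "q = {z \<in> p. fst z \<in> N}"
      have q: "q \<subseteq> p" "finite p" using pD(1) by (auto simp: q_def)
      define err where "err = (\<lambda>(x, K). measure lborel K * g x - (f (Sup K) - f (Inf K)))"
      have len: "(\<Sum>(x, K)\<in>p. Sup K - Inf K) = b - a"
        and inc: "(\<Sum>(x, K)\<in>p. f (Sup K) - f (Inf K)) = f b - f a"
        using additive_tagged_division_1[OF \<open>a \<le> b\<close> p', of "\<lambda>x. x"]
          additive_tagged_division_1[OF \<open>a \<le> b\<close> p', of f] by auto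
      have K: "Inf K \<in> {a..b}" "Sup K \<in> {a..b}" "Inf K \<in> K" "Sup K \<in> K" "Inf K \<le> x" "x \<le> Sup K"
        "measure lborel K = Sup K - Inf K" if xK: "(x, K) \<in> p" for x K
      proof -
        obtain u v where K: "K = {u..v}"
          using pD(4)[OF xK] by auto
        then have "u \<le> x" "x \<le> v" using pD(2)[OF xK] by auto
        then show "Inf K \<in> {a..b}" "Sup K \<in> {a..b}" "Inf K \<in> K" "Sup K \<in> K" "Inf K \<le> x" "x \<le> Sup K"
          "measure lborel K = Sup K - Inf K"
          using K pD(3)[OF xK] by auto
      qed
      have "(\<Sum>(x, K)\<in>p. measure lborel K *\<^sub>R g x) - (f b - f a) = sum err p"
        by (simp add: inc[symmetric] err_def split_beta sum_subtractf)
      also have "\<bar>\<dots>\<bar> \<le> (\<Sum>z\<in>p. \<bar>err z\<bar>)"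
        by (rule sum_abs)
      also have "\<dots> = (\<Sum>z\<in>q. \<bar>err z\<bar>) + (\<Sum>z\<in>p - q. \<bar>err z\<bar>)"
        using sum.subset_diff[OF q] by (simp add: add.commute)
      also have "(\<Sum>z\<in>p - q. \<bar>err z\<bar>) \<le> (\<Sum>z\<in>p - q. r * (Sup (snd z) - Inf (snd z)))"
      proof (rule sum_mono)
        fix z assume z: "z \<in> p - q"
        obtain x K where zeq: "z = (x, K)" by force
        have xK: "(x, K) \<in> p" "x \<notin> N" using z zeq by (auto simp: q_def)
        have "K \<subseteq> ball x (d x)"
          using fineD[OF fine xK(1)] xK(2) by (simp add: \<gamma>_def)
        then have "\<bar>Inf K - x\<bar> < d x" "\<bar>Sup K - x\<bar> < d x"
          using K(3,4)[OF xK(1)] by (auto simp: dist_real_def)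
        then show "\<bar>err z\<bar> \<le> r * (Sup (snd z) - Inf (snd z))"
          using d(2)[of x "Inf K" "Sup K"] K[OF xK(1)] xK(2)
          by (simp add: zeq err_def g_def)
      qed
      also have "\<dots> \<le> (\<Sum>z\<in>p. r * (Sup (snd z) - Inf (snd z)))"
        using q(2) r(1) K(5,6) by (intro sum_mono2) (force intro!: mult_nonneg_nonneg)+
      also have "\<dots> = r * (b - a)"
        by (simp add: len[symmetric] sum_distrib_left split_beta)
      also have "\<dots> < e / 2" by (rule r(2))
      also have "(\<Sum>z\<in>q. \<bar>err z\<bar>) = (\<Sum>(x, K)\<in>q. \<bar>f (Sup K) - f (Inf K)\<bar>)"
        by (rule sum.cong) (auto simp: q_def err_def g_def)
      also have "\<dots> < e / 2"
      proof (rule sum_increments_over_division_less[OF \<delta> _ U(3,4)])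
        show "q tagged_partial_division_of {a..b}"
          using p' q(1) tagged_partial_division_subset unfolding tagged_division_of_def by blast
        show "K \<subseteq> U" if "(x, K) \<in> q" for x K
          using that fineD[OF fine, of x K] by (auto simp: q_def \<gamma>_def)
      qed
      finally show ?thesis by simp
    qed
    ultimately show "\<exists>\<gamma>. gauge \<gamma> \<and> (\<forall>p. p tagged_division_of cbox a b \<and> \<gamma> fine p \<longrightarrow>
        norm ((\<Sum>(x, K)\<in>p. measure lborel K *\<^sub>R g x) - (f b - f a)) < e)"
      by (intro exI[of _ \<gamma>] conjI allI impI) auto
  qed
  then have "(g has_integral (f b - f a)) {a..b}" by simp
  then show ?thesis
    by (rule has_integral_spike[OF N, rotated]) (simp add: g_def)
qed

section \<open>Primitives of integrable functions\<close>

lemma integrable_mult_continuous: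
  fixes f g :: "real \<Rightarrow> real"
  assumes f: "integrable (lebesgue_on {a..b}) f" and g: "continuous_on {a..b} g"
  shows "integrable (lebesgue_on {a..b}) (\<lambda>x. f x * g x)"
proof -
  have "bounded (g ` {a..b})"
    using compact_continuous_image[OF g] compact_imp_bounded by blast
  then obtain C where "\<forall>y\<in>g ` {a..b}. norm y \<le> C"
    unfolding bounded_iff by blast
  then have C: "\<bar>g x\<bar> \<le> C" if "x \<in> {a..b}" for x
    using that by auto
  have "g \<in> borel_measurable (lebesgue_on {a..b})"
    by (rule continuous_imp_measurable_on_sets_lebesgue[OF g]) simp
  moreover have "f \<in> borel_measurable (lebesgue_on {a..b})"
    using f by (rule borel_measurable_integrable)
  moreover have "norm (f x * g x) \<le> norm (C * f x)" if "x \<in> {a..b}" for x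
  proof -
    have "\<bar>f x\<bar> * \<bar>g x\<bar> \<le> \<bar>f x\<bar> * \<bar>C\<bar>"
      using C[OF that] by (intro mult_left_mono) auto
    then show ?thesis by (simp add: abs_mult mult.commute)
  qed
  ultimately show ?thesis
    by (intro Bochner_Integration.integrable_bound[OF integrable_mult_right[OF f, of C]] AE_I2)
       auto
qed

lemma LINT_lebesgue_on_Icc_restrict:
  fixes f :: "real \<Rightarrow> real"
  assumes "s \<le> t"
  shows "(LINT r|lebesgue_on {a..s}. f r) = (LINT r|lebesgue_on {a..t}. indicator {..s} r * f r)"
proof -
  have eq: "(indicator {a..s} r :: real) = indicator {a..t} r * indicator {..s} r" for r
    using assms by (auto simp: indicator_def)
  show ?thesis
    by (simp add: integral_restrict_space eq mult.assoc)
qed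

lemma LINT_lebesgue_on_singleton:
  fixes f :: "real \<Rightarrow> real"
  shows "(LINT s|lebesgue_on {a..a}. f s) = 0"
proof (rule integral_eq_zero_AE)
  have "AE s in lebesgue. s \<in> {a..a} \<longrightarrow> f s = 0"
    using AE_completion[OF AE_lborel_singleton[of a]] by eventually_elim auto
  then show "AE s in lebesgue_on {a..a}. f s = 0"
    by (simp add: AE_restrict_space_iff)
qed

text \<open>The right-hand side is the integral of \<open>p x * q y\<close> over the square \<open>{a..t} \<times> {a..t}\<close>. Cutting the square
  along its diagonal and integrating each triangle first in the direction that ends at the
  diagonal gives the two iterated integrals.\<close>

lemma integral_mult_split_triangles:
  fixes p q :: "real \<Rightarrow> real"
  assumes p: "integrable (lebesgue_on {a..t}) p" and q: "integrable (lebesgue_on {a..t}) q"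
  shows "(LINT s|lebesgue_on {a..t}. p s * (LINT r|lebesgue_on {a..s}. q r)) +
         (LINT s|lebesgue_on {a..t}. q s * (LINT r|lebesgue_on {a..s}. p r)) =
         (LINT s|lebesgue_on {a..t}. p s) * (LINT s|lebesgue_on {a..t}. q s)"
proof -
  let ?M = "lebesgue_on {a..t}"
  interpret M: finite_measure ?M
    by (rule finite_measure_lebesgue_on) simp
  interpret pair_sigma_finite ?M ?M ..
  have [measurable]: "p \<in> borel_measurable ?M" "q \<in> borel_measurable ?M"
    using p q by (auto intro: borel_measurable_integrable)
  have [measurable]: "(\<lambda>x. x) \<in> ?M \<rightarrow>\<^sub>M borel"
    by (intro measurable_restrict_space1 measurable_completion) simp
  have [measurable]: "Measurable.pred (?M \<Otimes>\<^sub>M ?M) (\<lambda>(x, y). y \<le> x)"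
    "Measurable.pred (?M \<Otimes>\<^sub>M ?M) (\<lambda>(x, y). x < y)"
    by measurable
  have pq: "integrable (?M \<Otimes>\<^sub>M ?M) (\<lambda>(x, y). p x * q y)"
  proof (rule Fubini_integrable)
    show "(\<lambda>(x, y). p x * q y) \<in> borel_measurable (?M \<Otimes>\<^sub>M ?M)" by measurable
    show "integrable ?M (\<lambda>x. LINT y|?M. norm (case (x, y) of (x, y) \<Rightarrow> p x * q y))"
      using p by (simp add: abs_mult)
    show "AE x in ?M. integrable ?M (\<lambda>y. case (x, y) of (x, y) \<Rightarrow> p x * q y)"
      using q by simp
  qed
  define lo up where "lo = (\<lambda>x y. indicator {..x} y * (p x * q y))"
    and "up = (\<lambda>x y. indicator {..<y} x * (p x * q y))"
  have lo: "integrable (?M \<Otimes>\<^sub>M ?M) (case_prod lo)"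
  proof (rule Bochner_Integration.integrable_bound[OF pq])
    have "case_prod lo = (\<lambda>z. if (case z of (x, y) \<Rightarrow> y \<le> x) then (case z of (x, y) \<Rightarrow> p x * q y) else 0)"
      by (auto simp: lo_def indicator_def)
    then show "case_prod lo \<in> borel_measurable (?M \<Otimes>\<^sub>M ?M)" by simp
  qed (auto simp: lo_def indicator_def)
  have up: "integrable (?M \<Otimes>\<^sub>M ?M) (case_prod up)"
  proof (rule Bochner_Integration.integrable_bound[OF pq])
    have "case_prod up = (\<lambda>z. if (case z of (x, y) \<Rightarrow> x < y) then (case z of (x, y) \<Rightarrow> p x * q y) else 0)"
      by (auto simp: up_def indicator_def)
    then show "case_prod up \<in> borel_measurable (?M \<Otimes>\<^sub>M ?M)" by simp
  qed (auto simp: up_def indicator_def)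
  have "(LINT x|?M. p x) * (LINT y|?M. q y) = (LINT x|?M. (LINT y|?M. p x * q y))"
    by simp
  also have "\<dots> = integral\<^sup>L (?M \<Otimes>\<^sub>M ?M) (\<lambda>(x, y). p x * q y)"
    by (rule integral_fst[OF pq])
  also have "(\<lambda>(x, y). p x * q y) = (\<lambda>z. case_prod lo z + case_prod up z)"
    by (auto simp: lo_def up_def indicator_def)
  also have "integral\<^sup>L (?M \<Otimes>\<^sub>M ?M) \<dots> = (LINT x|?M. LINT y|?M. lo x y) + (LINT y|?M. LINT x|?M. up x y)"
    by (simp only: Bochner_Integration.integral_add[OF lo up] integral_fst[OF lo] integral_snd[OF up])
  also have "(LINT x|?M. LINT y|?M. lo x y) = (LINT s|?M. p s * (LINT r|lebesgue_on {a..s}. q r))"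
  proof (rule Bochner_Integration.integral_cong[OF refl])
    fix x assume "x \<in> space ?M"
    then have "(LINT r|lebesgue_on {a..x}. q r) = (LINT y|?M. indicator {..x} y * q y)"
      by (intro LINT_lebesgue_on_Icc_restrict) simp
    then show "(LINT y|?M. lo x y) = p x * (LINT r|lebesgue_on {a..x}. q r)"
      by (simp add: lo_def mult.left_commute)
  qed
  also have "(LINT y|?M. LINT x|?M. up x y) = (LINT s|?M. q s * (LINT r|lebesgue_on {a..s}. p r))"
  proof (rule Bochner_Integration.integral_cong[OF refl])
    fix y assume "y \<in> space ?M"
    \<comment> \<open>The triangles are disjoint, so one of them lacks the diagonal, which is a null set on each line.\<close>
    have "AE x in ?M. x \<noteq> y"
      using AE_completion[OF AE_lborel_singleton[of y]]
      by (subst AE_restrict_space_iff) auto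
    then have "AE x in ?M. up x y = indicator {..y} x * (p x * q y)"
      by eventually_elim (auto simp: up_def indicator_def)
    then have "(LINT x|?M. up x y) = (LINT x|?M. indicator {..y} x * (p x * q y))"
      by (intro integral_cong_AE) (auto simp: up_def)
    also have "\<dots> = q y * (LINT x|?M. indicator {..y} x * p x)"
      by (simp flip: integral_mult_right_zero add: ac_simps)
    also have "(LINT x|?M. indicator {..y} x * p x) = (LINT r|lebesgue_on {a..y}. p r)"
      using \<open>y \<in> space ?M\<close> by (intro LINT_lebesgue_on_Icc_restrict[symmetric]) simp
    finally show "(LINT x|?M. up x y) = q y * (LINT r|lebesgue_on {a..y}. p r)" .
  qed
  finally show ?thesis by simp
qed

text \<open>Being an indefinite integral, as opposed to having \<open>p\<close> as derivative almost everywhere: for merely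
  integrable \<open>p\<close> this form supports integration by parts without Lebesgue's differentiation
  theorem.\<close>

definition primitive_on :: "real \<Rightarrow> real \<Rightarrow> (real \<Rightarrow> real) \<Rightarrow> (real \<Rightarrow> real) \<Rightarrow> bool" where
  "primitive_on a b p P \<longleftrightarrow> integrable (lebesgue_on {a..b}) p \<and>
     (\<forall>t\<in>{a..b}. P t = P a + (LINT s|lebesgue_on {a..t}. p s))"

lemma primitive_onD:
  assumes "primitive_on a b p P"
  shows "integrable (lebesgue_on {a..b}) p"
    and "t \<in> {a..b} \<Longrightarrow> P t = P a + (LINT s|lebesgue_on {a..t}. p s)"
    and "t \<in> {a..b} \<Longrightarrow> integrable (lebesgue_on {a..t}) p"
proof -
  show int: "integrable (lebesgue_on {a..b}) p"
    using assms unfolding primitive_on_def by blast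
  show "t \<in> {a..b} \<Longrightarrow> P t = P a + (LINT s|lebesgue_on {a..t}. p s)"
    using assms unfolding primitive_on_def by blast
  show "t \<in> {a..b} \<Longrightarrow> integrable (lebesgue_on {a..t}) p"
    using integrable_subinterval[OF int] by simp
qed

lemma primitive_on_indefinite_integral:
  assumes "integrable (lebesgue_on {a..b}) p"
  shows "primitive_on a b p (\<lambda>t. LINT s|lebesgue_on {a..t}. p s)"
  using assms unfolding primitive_on_def LINT_lebesgue_on_singleton by simp

lemma primitive_on_continuous:
  assumes "primitive_on a b p P"
  shows "continuous_on {a..b} P"
proof -
  have "continuous_on {a..b} (\<lambda>t. P a + (LINT s|lebesgue_on {a..t}. p s))"
    by (intro continuous_intros indefinite_integral_continuous_real primitive_onD[OF assms])
  then show ?thesis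
    by (rule continuous_on_eq) (rule primitive_onD(2)[OF assms, symmetric])
qed

lemma primitive_on_add:
  assumes "primitive_on a b p P" "primitive_on a b q Q"
  shows "primitive_on a b (\<lambda>x. p x + q x) (\<lambda>x. P x + Q x)"
  unfolding primitive_on_def
proof (intro conjI ballI)
  show "integrable (lebesgue_on {a..b}) (\<lambda>x. p x + q x)"
    using primitive_onD(1)[OF assms(1)] primitive_onD(1)[OF assms(2)] by simp
  fix t assume t: "t \<in> {a..b}"
  show "P t + Q t = P a + Q a + (LINT s|lebesgue_on {a..t}. p s + q s)"
    using primitive_onD(3)[OF assms(1) t] primitive_onD(3)[OF assms(2) t]
    by (subst primitive_onD(2)[OF assms(1) t], subst primitive_onD(2)[OF assms(2) t]) simp
qed

lemma primitive_on_cmult: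
  assumes "primitive_on a b p P"
  shows "primitive_on a b (\<lambda>x. c * p x) (\<lambda>x. c * P x)"
  unfolding primitive_on_def
proof (intro conjI ballI)
  show "integrable (lebesgue_on {a..b}) (\<lambda>x. c * p x)"
    using primitive_onD(1)[OF assms] by simp
  fix t assume t: "t \<in> {a..b}"
  show "c * P t = c * P a + (LINT s|lebesgue_on {a..t}. c * p s)"
    by (subst primitive_onD(2)[OF assms t]) (simp add: algebra_simps)
qed

lemma primitive_on_diff:
  assumes "primitive_on a b p P" "primitive_on a b q Q"
  shows "primitive_on a b (\<lambda>x. p x - q x) (\<lambda>x. P x - Q x)"
  using primitive_on_add[OF assms(1) primitive_on_cmult[OF assms(2), of "-1"]] by simp

lemma primitive_on_cong:
  assumes "primitive_on a b p P" "\<And>x. x \<in> {a..b} \<Longrightarrow> p' x = p x" "\<And>x. x \<in> {a..b} \<Longrightarrow> P' x = P x" "a \<le> b"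
  shows "primitive_on a b p' P'"
  unfolding primitive_on_def
proof (intro conjI ballI)
  have "integrable (lebesgue_on {a..b}) p' \<longleftrightarrow> integrable (lebesgue_on {a..b}) p"
    using assms(2) by (intro Bochner_Integration.integrable_cong) auto
  then show "integrable (lebesgue_on {a..b}) p'"
    using primitive_onD(1)[OF assms(1)] by simp
  fix t assume t: "t \<in> {a..b}"
  have "(LINT s|lebesgue_on {a..t}. p' s) = (LINT s|lebesgue_on {a..t}. p s)"
    using assms(2) t by (intro Bochner_Integration.integral_cong) auto
  moreover have "P' t = P t" "P' a = P a"
    using assms(3,4) t by auto
  ultimately show "P' t = P' a + (LINT s|lebesgue_on {a..t}. p' s)"
    using primitive_onD(2)[OF assms(1) t] by metis
qed

text \<open>Writing both factors as initial value plus indefinite integral, only the product of the two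
  indefinite integrals is not immediate, and that term is the splitting into triangles.\<close>

lemma primitive_on_mult:
  assumes P: "primitive_on a b p P" and Q: "primitive_on a b q Q"
  shows "primitive_on a b (\<lambda>x. p x * Q x + q x * P x) (\<lambda>x. P x * Q x)"
  unfolding primitive_on_def
proof (intro conjI ballI)
  note cont = primitive_on_continuous[OF P] primitive_on_continuous[OF Q]
  have int: "integrable (lebesgue_on {a..b}) (\<lambda>x. p x * Q x)"
    "integrable (lebesgue_on {a..b}) (\<lambda>x. q x * P x)"
    using integrable_mult_continuous primitive_onD(1) P Q cont by blast+
  then show "integrable (lebesgue_on {a..b}) (\<lambda>x. p x * Q x + q x * P x)" by simp
  fix t assume t: "t \<in> {a..b}"
  let ?M = "lebesgue_on {a..t}"
  define ip iq where "ip s = (LINT r|lebesgue_on {a..s}. p r)"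
    and "iq s = (LINT r|lebesgue_on {a..s}. q r)" for s
  have pq: "integrable ?M p" "integrable ?M q"
    using primitive_onD(3) P Q t by blast+
  have "continuous_on {a..t} ip" "continuous_on {a..t} iq"
    unfolding ip_def iq_def using pq by (auto intro: indefinite_integral_continuous_real)
  then have int': "integrable ?M (\<lambda>s. p s * iq s)" "integrable ?M (\<lambda>s. q s * ip s)"
    using pq by (auto intro: integrable_mult_continuous)
  have "(LINT s|?M. p s * Q s + q s * P s) =
      (LINT s|?M. (Q a * p s + P a * q s) + (p s * iq s + q s * ip s))"
  proof (rule Bochner_Integration.integral_cong[OF refl])
    fix s assume "s \<in> space ?M"
    then have s: "s \<in> {a..b}" using t by simp
    show "p s * Q s + q s * P s = (Q a * p s + P a * q s) + (p s * iq s + q s * ip s)"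
      by (subst primitive_onD(2)[OF P s], subst primitive_onD(2)[OF Q s])
         (simp add: ip_def iq_def algebra_simps)
  qed
  also have "\<dots> = Q a * ip t + P a * iq t + ((LINT s|?M. p s * iq s) + (LINT s|?M. q s * ip s))"
    using pq int' by (simp add: ip_def[of t] iq_def[of t])
  also have "\<dots> = Q a * ip t + P a * iq t + ip t * iq t"
    using integral_mult_split_triangles[OF pq] by (simp add: ip_def iq_def)
  also have "\<dots> = P t * Q t - P a * Q a"
    by (subst primitive_onD(2)[OF P t], subst primitive_onD(2)[OF Q t])
       (simp add: ip_def iq_def algebra_simps)
  finally show "P t * Q t = P a * Q a + (LINT s|?M. p s * Q s + q s * P s)"
    by simp
qed

lemma primitive_on_C1:
  assumes deriv: "\<And>x. x \<in> {a..b} \<Longrightarrow> (P has_real_derivative p x) (at x)"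
    and cont: "continuous_on {a..b} p"
  shows "primitive_on a b p P"
  unfolding primitive_on_def
proof (intro conjI ballI)
  show int: "integrable (lebesgue_on {a..b}) p"
    by (rule continuous_imp_integrable_real[OF cont])
  fix t assume t: "t \<in> {a..b}"
  have "(p has_integral (P t - P a)) {a..t}"
  proof (rule fundamental_theorem_of_calculus)
    fix x assume "x \<in> {a..t}"
    then have "(P has_real_derivative p x) (at x within {a..t})"
      using t by (intro has_field_derivative_at_within[OF deriv]) simp
    then show "(P has_vector_derivative p x) (at x within {a..t})"
      by (simp add: has_real_derivative_iff_has_vector_derivative)
  qed (use t in simp)
  moreover have "integrable (lebesgue_on {a..t}) p"
    using integrable_subinterval[OF int] t by auto
  ultimately have "(LINT s|lebesgue_on {a..t}. p s) = P t - P a"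
    by (simp add: lebesgue_integral_eq_integral integral_unique)
  then show "P t = P a + (LINT s|lebesgue_on {a..t}. p s)" by simp
qed

lemma primitive_on_has_real_derivative:
  assumes P: "primitive_on a b p P" and cont: "continuous_on {a..b} p" and t: "t \<in> {a<..<b}"
  shows "(P has_real_derivative p t) (at t)"
proof -
  have t': "t \<in> {a..b}" "t \<in> interior {a..b}" using t by auto
  have D: "((\<lambda>x. P a + integral {a..x} p) has_real_derivative p t) (at t within {a..b})"
    using integral_has_real_derivative[OF cont t'(1)] by (auto intro: derivative_eq_intros)
  have "P a + integral {a..x} p = P x" if "x \<in> {a..b}" for x
    using lebesgue_integral_eq_integral[OF primitive_onD(3)[OF P that]]
    by (subst primitive_onD(2)[OF P that]) simp
  then have "(P has_real_derivative p t) (at t within {a..b})"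
    by (rule has_field_derivative_transform_within[OF D zero_less_one t'(1)])
  then show ?thesis
    using at_within_interior[OF t'(2)] by simp
qed

lemma primitive_on_absolutely_continuous:
  assumes ac: "absolutely_continuous_on_interval a b f" 
    and diff: "AE t in lebesgue_on {a..b}. f differentiable (at t)"
    and int: "integrable (lebesgue_on {a..b}) (deriv f)"
  shows "primitive_on a b (deriv f) f"
  unfolding primitive_on_def
proof (intro conjI ballI)
  fix t assume t: "t \<in> {a..b}"
  have ac': "absolutely_continuous_on_interval a t f"
    using ac t by (auto intro: absolutely_continuous_on_subinterval)
  have "AE x in lebesgue. x \<in> {a..b} \<longrightarrow> f differentiable (at x)"
    using diff by (simp add: AE_restrict_space_iff)
  then obtain N where N: "\<And>x. x \<in> space lebesgue - N \<Longrightarrow> x \<in> {a..b} \<longrightarrow> f differentiable (at x)"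
    and "N \<in> null_sets lebesgue"
    by (rule AE_E3) (rule that)
  then have "negligible N"
    by (simp add: negligible_iff_null_sets)
  moreover have "(f has_real_derivative deriv f x) (at x within {a..t})" if "x \<in> {a..t} - N" for x
  proof -
    have "f differentiable (at x)" using that t N by auto
    then have "(f has_real_derivative deriv f x) (at x)"
      by (simp add: DERIV_deriv_iff_real_differentiable)
    then show ?thesis by (rule has_field_derivative_at_within)
  qed
  ultimately have "(deriv f has_integral (f t - f a)) {a..t}"
    using absolutely_continuous_has_integral_derivative[OF _ ac', of N "deriv f"] t by simp
  moreover have "integrable (lebesgue_on {a..t}) (deriv f)"
    using integrable_subinterval[OF int] t by auto
  ultimately have "(LINT s|lebesgue_on {a..t}. deriv f s) = f t - f a"
    by (simp add: lebesgue_integral_eq_integral integral_unique)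
  then show "f t = f a + (LINT s|lebesgue_on {a..t}. deriv f s)" by simp
qed (rule int)

lemma AE_deriv_primitive_on:
  assumes "primitive_on a b p P" "continuous_on {a..b} p"
  shows "AE t in lebesgue_on {a..b}. (P has_real_derivative p t) (at t)"
proof -
  have "AE t in lebesgue. t \<noteq> a \<and> t \<noteq> b"
    using AE_completion[OF AE_lborel_singleton[of a]] AE_completion[OF AE_lborel_singleton[of b]]
    by eventually_elim simp
  then have "AE t in lebesgue. t \<in> {a..b} \<longrightarrow> (P has_real_derivative p t) (at t)"
    by eventually_elim (auto intro!: primitive_on_has_real_derivative[OF assms])
  then show ?thesis by (simp add: AE_restrict_space_iff)
qed

lemma primitive_on_imp_absolutely_continuous:
  assumes P: "primitive_on a b p P" and cont: "continuous_on {a..b} p"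
  shows "absolutely_continuous_on_interval a b P"
proof -
  have "bounded (p ` {a..b})"
    using compact_continuous_image[OF cont] compact_imp_bounded by blast
  then obtain L where L: "L > 0" "\<forall>y\<in>p ` {a..b}. norm y \<le> L"
    unfolding bounded_pos by blast
  have "\<bar>P v - P u\<bar> \<le> L * (v - u)" if uv: "a \<le> u" "u \<le> v" "v \<le> b" for u v
  proof (cases "u = v")
    case False
    have "continuous_on {u..v} P"
      using primitive_on_continuous[OF P] by (rule continuous_on_subset) (use uv in auto)
    moreover have "(P has_real_derivative p x) (at x)" if "u < x" "x < v" for x
      using that uv by (intro primitive_on_has_real_derivative[OF P cont]) auto
    ultimately obtain l z where z: "u < z" "z < v" "DERIV P z :> l" "P v - P u = (v - u) * l"
      using MVT[of u v P] False uv(2) unfolding real_differentiable_def by (metis order_le_less)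
    have "(P has_real_derivative p z) (at z)"
      using z(1,2) uv by (intro primitive_on_has_real_derivative[OF P cont]) auto
    then have "l = p z" using z(3) DERIV_unique by blast
    moreover have "\<bar>p z\<bar> \<le> L" using L(2) z(1,2) uv by auto
    ultimately show ?thesis
      using z(4) uv(2) by (simp add: abs_mult mult.commute mult_right_mono)
  qed simp
  then show ?thesis
    using L(1) by (rule absolutely_continuous_on_interval_Lipschitz)
qed

section \<open>Square-integrable functions and the Sobolev space\<close>

lemma square_integrable_on_imp_integrable_mult:
  assumes "square_integrable_on S f" "square_integrable_on S g"
  shows "integrable (lebesgue_on S) (\<lambda>x. f x * g x)"
proof (rule Bochner_Integration.integrable_bound)
  show "integrable (lebesgue_on S) (\<lambda>x. (f x)\<^sup>2 + (g x)\<^sup>2)"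
    using assms by (simp add: square_integrable_on_def)
  show "(\<lambda>x. f x * g x) \<in> borel_measurable (lebesgue_on S)"
    using assms by (intro borel_measurable_times) (simp_all add: square_integrable_on_def)
  have "\<bar>f x * g x\<bar> \<le> (f x)\<^sup>2 + (g x)\<^sup>2" for x
  proof -
    have "2 * (\<bar>f x\<bar> * \<bar>g x\<bar>) \<le> (f x)\<^sup>2 + (g x)\<^sup>2"
      using sum_squares_bound[of "\<bar>f x\<bar>" "\<bar>g x\<bar>"] by simp
    moreover have "0 \<le> \<bar>f x\<bar> * \<bar>g x\<bar>" by simp
    ultimately show ?thesis unfolding abs_mult by linarith
  qed
  then show "AE x in lebesgue_on S. norm (f x * g x) \<le> norm ((f x)\<^sup>2 + (g x)\<^sup>2)"
    by simp
qed

lemma square_integrable_on_diff: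
  assumes f: "square_integrable_on S f" and g: "square_integrable_on S g"
  shows "square_integrable_on S (\<lambda>x. f x - g x)"
proof -
  have "integrable (lebesgue_on S) (\<lambda>x. (f x)\<^sup>2 + (g x)\<^sup>2 - 2 * (f x * g x))"
    using f g square_integrable_on_imp_integrable_mult[OF f g]
    by (simp add: square_integrable_on_def)
  then have "integrable (lebesgue_on S) (\<lambda>x. (f x - g x)\<^sup>2)"
    by (simp add: power2_diff mult.assoc)
  moreover have "(\<lambda>x. f x - g x) \<in> borel_measurable (lebesgue_on S)"
    using f g by (intro borel_measurable_diff) (simp_all add: square_integrable_on_def)
  ultimately show ?thesis
    by (simp add: square_integrable_on_def)
qed

lemma continuous_on_imp_square_integrable_on:
  assumes "continuous_on {a..b::real} f"
  shows "square_integrable_on {a..b} f"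
  using assms unfolding square_integrable_on_def
  by (auto intro!: continuous_imp_integrable_real continuous_intros
        continuous_imp_measurable_on_sets_lebesgue)

lemma square_integrable_on_imp_integrable:
  assumes "square_integrable_on {a..b} f"
  shows "integrable (lebesgue_on {a..b}) f"
  using square_integrable_on_imp_integrable_mult[OF assms
      continuous_on_imp_square_integrable_on[of a b "\<lambda>_. 1"]] by simp

lemma sobolev_W21_primitive_on:
  assumes "f \<in> sobolev_W21 T"
  shows "primitive_on 0 T (deriv f) f"
  using assms square_integrable_on_imp_integrable
  by (intro primitive_on_absolutely_continuous) (auto simp: sobolev_W21_def)

text \<open>With a continuous \<open>p\<close> the derivative of \<open>P\<close> is \<open>p\<close> in the open interval; at \<open>0\<close> and \<open>T\<close> it depends on
  the values of \<open>P\<close> outside \<open>[0, T]\<close>, which is why \<open>deriv P\<close> and \<open>p\<close> are compared away from two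
  points.\<close>

lemma primitive_on_continuous_imp_sobolev_W21:
  assumes P: "primitive_on 0 T p P" and cont: "continuous_on {0..T} p"
  shows "P \<in> sobolev_W21 T"
proof -
  have deriv: "p t = deriv P t" if "t \<in> space (lebesgue_on {0..T})" "t \<notin> {0, T}" for t
    using that primitive_on_has_real_derivative[OF P cont, of t] by (simp add: DERIV_imp_deriv)
  have p: "square_integrable_on {0..T} p"
    by (rule continuous_on_imp_square_integrable_on[OF cont])
  have null: "emeasure (lebesgue_on {0..T}) {x} = 0" "{x} \<in> sets (lebesgue_on {0..T})"
    if "x \<in> {0, T}" "x \<in> space (lebesgue_on {0..T})" for x
    using that by (auto simp: emeasure_restrict_space sets_restrict_space_iff)
  have "deriv P \<in> borel_measurable (lebesgue_on {0..T})"
  proof (rule measurable_discrete_difference[where f = p and X = "{0, T} \<inter> {0..T}"])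
    show "p \<in> borel_measurable (lebesgue_on {0..T})"
      using p by (simp add: square_integrable_on_def)
  qed (use deriv null in auto)
  moreover have "integrable (lebesgue_on {0..T}) (\<lambda>t. (p t)\<^sup>2) \<longleftrightarrow>
      integrable (lebesgue_on {0..T}) (\<lambda>t. (deriv P t)\<^sup>2)"
    by (rule integrable_discrete_difference[where X = "{0, T} \<inter> {0..T}"])
       (use deriv null in auto)
  ultimately have "square_integrable_on {0..T} (deriv P)"
    using p by (simp add: square_integrable_on_def)
  moreover have "AE t in lebesgue_on {0..T}. P differentiable (at t)"
    using AE_deriv_primitive_on[OF P cont] by eventually_elim (auto simp: real_differentiable_def)
  ultimately show ?thesis
    using primitive_on_imp_absolutely_continuous[OF P cont] by (simp add: sobolev_W21_def)
qed

section \<open>The Euler--Lagrange equation\<close>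

text \<open>Variation of constants for \<open>S'' = S + B\<close> with zero initial data. The addition theorems
  turn both convolutions into combinations of \<open>sinh\<close> and \<open>cosh\<close> with the indefinite integrals \<open>C\<close> and
  \<open>D\<close>. In \<open>S'\<close> the terms from differentiating \<open>C\<close> and \<open>D\<close> cancel, and in \<open>K'\<close> they leave
  \<open>B * (cosh\<^sup>2 - sinh\<^sup>2) = B\<close>.\<close>

lemma hyperbolic_convolution:
  fixes B :: "real \<Rightarrow> real"
  assumes B: "integrable (lebesgue_on {a..b}) B"
  defines "S \<equiv> \<lambda>u. LINT s|lebesgue_on {a..u}. B s * sinh (u - s)"
    and "K \<equiv> \<lambda>u. LINT s|lebesgue_on {a..u}. B s * cosh (u - s)"
  assumes "a \<le> b"
  shows "primitive_on a b K S" and "primitive_on a b (\<lambda>u. S u + B u) K"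
proof -
  define C where "C = (\<lambda>u. LINT s|lebesgue_on {a..u}. B s * cosh s)"
  define D where "D = (\<lambda>u. LINT s|lebesgue_on {a..u}. B s * sinh s)"
  have int: "integrable (lebesgue_on {a..b}) (\<lambda>s. B s * cosh s)"
    "integrable (lebesgue_on {a..b}) (\<lambda>s. B s * sinh s)"
    by (intro integrable_mult_continuous[OF B] continuous_intros)+
  have C: "primitive_on a b (\<lambda>s. B s * cosh s) C" and D: "primitive_on a b (\<lambda>s. B s * sinh s) D"
    unfolding C_def D_def by (intro primitive_on_indefinite_integral int)+
  have sinh: "primitive_on a b cosh (sinh :: real \<Rightarrow> real)"
    and cosh: "primitive_on a b sinh (cosh :: real \<Rightarrow> real)"
    by (rule primitive_on_C1, auto intro!: derivative_eq_intros continuous_intros)+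
  have SK: "S u = sinh u * C u - cosh u * D u" "K u = cosh u * C u - sinh u * D u"
    if u: "u \<in> {a..b}" for u
  proof -
    note int_u = integrable_subinterval[OF int(1), of a u] integrable_subinterval[OF int(2), of a u]
    have "S u = (LINT s|lebesgue_on {a..u}. sinh u * (B s * cosh s) - cosh u * (B s * sinh s))"
      by (simp add: S_def sinh_diff algebra_simps)
    then show "S u = sinh u * C u - cosh u * D u"
      using int_u u by (simp add: C_def D_def)
    have "K u = (LINT s|lebesgue_on {a..u}. cosh u * (B s * cosh s) - sinh u * (B s * sinh s))"
      by (simp add: K_def cosh_diff algebra_simps)
    then show "K u = cosh u * C u - sinh u * D u"
      using int_u u by (simp add: C_def D_def)
  qed
  show "primitive_on a b K S"
    by (rule primitive_on_cong[OF primitive_on_diff[OF primitive_on_mult[OF sinh C] primitive_on_mult[OF cosh D]]])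
       (use \<open>a \<le> b\<close> in \<open>simp_all add: SK algebra_simps\<close>)
  show "primitive_on a b (\<lambda>u. S u + B u) K"
  proof (rule primitive_on_cong[OF primitive_on_diff[OF primitive_on_mult[OF cosh C] primitive_on_mult[OF sinh D]]])
    fix u assume u: "u \<in> {a..b}"
    have "B u * (cosh u * cosh u) - B u * (sinh u * sinh u) = B u"
      using cosh_square_eq[of u] by (simp add: power2_eq_square algebra_simps)
    then show "S u + B u = sinh u * C u + B u * cosh u * cosh u - (cosh u * D u + B u * sinh u * sinh u)"
      using SK(1)[OF u] by (simp add: algebra_simps)
  qed (use \<open>a \<le> b\<close> in \<open>simp_all add: SK\<close>)
qed

definition minimizer :: "real \<Rightarrow> (real \<Rightarrow> real) \<Rightarrow> real \<Rightarrow> real" where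
  "minimizer T B t = - (LINT s|lebesgue_on {0..t}. B s * sinh (t - s))
     + (LINT s|lebesgue_on {0..T}. B s * cosh (T - s)) / (exp T - exp (- T)) * (exp t + exp (- t))"

definition minimizer_deriv :: "real \<Rightarrow> (real \<Rightarrow> real) \<Rightarrow> real \<Rightarrow> real" where
  "minimizer_deriv T B t = - (LINT s|lebesgue_on {0..t}. B s * cosh (t - s))
     + (LINT s|lebesgue_on {0..T}. B s * cosh (T - s)) / (exp T - exp (- T)) * (exp t - exp (- t))"

text \<open>The Euler--Lagrange equation \<open>m'' = m - B\<close>, split into two first-order equations, and its natural
  boundary conditions. The one at \<open>T\<close> is what determines the coefficient of \<open>exp t + exp (- t)\<close>.\<close>

lemma minimizer_euler_lagrange:
  assumes "T > 0" and B: "integrable (lebesgue_on {0..T}) B"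
  shows "primitive_on 0 T (minimizer_deriv T B) (minimizer T B)"
    and "primitive_on 0 T (\<lambda>t. minimizer T B t - B t) (minimizer_deriv T B)"
    and "minimizer_deriv T B 0 = 0" and "minimizer_deriv T B T = 0"
proof -
  define c where "c = (LINT s|lebesgue_on {0..T}. B s * cosh (T - s)) / (exp T - exp (- T))"
  define S where "S u = (LINT s|lebesgue_on {0..u}. B s * sinh (u - s))" for u
  define K where "K u = (LINT s|lebesgue_on {0..u}. B s * cosh (u - s))" for u
  have SK: "primitive_on 0 T K S" "primitive_on 0 T (\<lambda>u. S u + B u) K"
    using hyperbolic_convolution[OF B] \<open>T > 0\<close> by (simp_all add: S_def[abs_def] K_def[abs_def])
  have exps: "primitive_on 0 T (\<lambda>t. c * (exp t - exp (- t))) (\<lambda>t. c * (exp t + exp (- t)))"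
    "primitive_on 0 T (\<lambda>t. c * (exp t + exp (- t))) (\<lambda>t. c * (exp t - exp (- t)))"
    by (rule primitive_on_C1, auto intro!: derivative_eq_intros continuous_intros)+
  show "primitive_on 0 T (minimizer_deriv T B) (minimizer T B)"
    by (rule primitive_on_cong[OF primitive_on_diff[OF exps(1) SK(1)]])
       (use \<open>T > 0\<close> in \<open>simp_all add: minimizer_def minimizer_deriv_def S_def K_def c_def\<close>)
  show "primitive_on 0 T (\<lambda>t. minimizer T B t - B t) (minimizer_deriv T B)"
    by (rule primitive_on_cong[OF primitive_on_diff[OF exps(2) SK(2)]])
       (use \<open>T > 0\<close> in \<open>simp_all add: minimizer_def minimizer_deriv_def S_def K_def c_def\<close>)
  have "K 0 = 0"
    by (simp only: K_def LINT_lebesgue_on_singleton)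
  then show "minimizer_deriv T B 0 = 0"
    by (simp add: minimizer_deriv_def K_def)
  have "exp T - exp (- T) > 0" using \<open>T > 0\<close> by simp
  then show "minimizer_deriv T B T = 0"
    by (simp add: minimizer_deriv_def)
qed

section \<open>Minimality and uniqueness\<close>

text \<open>The integrand is the derivative of \<open>h * m'\<close>, and \<open>m'\<close> vanishes at both ends, so the
  end values of \<open>h\<close> are arbitrary.\<close>

lemma first_variation_minimizer:
  assumes "T > 0" "integrable (lebesgue_on {0..T}) B" and h: "primitive_on 0 T p h"
  shows "(LINT t|lebesgue_on {0..T}. p t * minimizer_deriv T B t + (minimizer T B t - B t) * h t) = 0"
  using primitive_onD(2)[OF primitive_on_mult[OF h minimizer_euler_lagrange(2)[OF assms(1,2)]], of T]
    minimizer_euler_lagrange(3,4)[OF assms(1,2)] \<open>T > 0\<close>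
  by simp

text \<open>Completing the square. The energy of the minimizer is expressed through an arbitrary \<open>f\<close> that agrees
  with it on \<open>[0, T]\<close>, since solutions are only determined there. The other two claims
  serve uniqueness: they let the integral of the second square be bounded by the whole excess, and
  a continuous function whose square has integral zero vanishes everywhere.\<close>

lemma energy_eq_energy_minimizer_plus:
  assumes T: "T > 0" and B: "square_integrable_on {0..T} B"
    and u: "u \<in> sobolev_W21 T" and f: "\<And>t. t \<in> {0..T} \<Longrightarrow> f t = minimizer T B t"
  shows "energy T B u = energy T B f +
      (LINT t|lebesgue_on {0..T}. (deriv u t - minimizer_deriv T B t)\<^sup>2 + (u t - minimizer T B t)\<^sup>2)"
    and "integrable (lebesgue_on {0..T}) (\<lambda>t. (deriv u t - minimizer_deriv T B t)\<^sup>2)"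
    and "continuous_on {0..T} (\<lambda>t. u t - minimizer T B t)"
proof -
  define m where "m = minimizer T B"
  define m' where "m' = minimizer_deriv T B"
  define h where "h t = u t - m t" for t
  define p where "p t = deriv u t - m' t" for t
  let ?L = "lebesgue_on {0..T}"
  note B1 = square_integrable_on_imp_integrable[OF B]
  note m = minimizer_euler_lagrange(1)[OF T B1, folded m_def m'_def]
  have m': "continuous_on {0..T} m'"
    using primitive_on_continuous[OF minimizer_euler_lagrange(2)[OF T B1]] by (simp add: m'_def)
  note U = sobolev_W21_primitive_on[OF u]
  have h: "primitive_on 0 T p h"
    using primitive_on_diff[OF U m] by (simp add: p_def[abs_def] h_def[abs_def])
  show cont: "continuous_on {0..T} (\<lambda>t. u t - minimizer T B t)"
    using primitive_on_continuous[OF h] by (simp add: h_def m_def)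
  have cont_L2: "square_integrable_on {0..T} h" "square_integrable_on {0..T} m'"
    "square_integrable_on {0..T} m"
    using primitive_on_continuous[OF h] primitive_on_continuous[OF m] m'
    by (blast intro: continuous_on_imp_square_integrable_on)+
  have "square_integrable_on {0..T} (deriv u)"
    using u by (simp add: sobolev_W21_def)
  then have L2: "square_integrable_on {0..T} p" "square_integrable_on {0..T} h"
    "square_integrable_on {0..T} m'" "square_integrable_on {0..T} (\<lambda>t. m t - B t)"
    using cont_L2 B unfolding p_def by (blast intro: square_integrable_on_diff)+
  then show "integrable ?L (\<lambda>t. (deriv u t - minimizer_deriv T B t)\<^sup>2)"
    by (simp add: square_integrable_on_def p_def m'_def)
  have int: "integrable ?L (\<lambda>t. (m' t)\<^sup>2 + (m t - B t)\<^sup>2)" "integrable ?L (\<lambda>t. (p t)\<^sup>2 + (h t)\<^sup>2)"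
    using L2 by (simp_all add: square_integrable_on_def)
  have cross: "integrable ?L (\<lambda>t. p t * m' t + (m t - B t) * h t)"
    using square_integrable_on_imp_integrable_mult L2 by (intro Bochner_Integration.integrable_add) blast+
  have "f \<in> sobolev_W21 T" and fprim: "primitive_on 0 T m' f"
  proof -
    show "primitive_on 0 T m' f"
      by (rule primitive_on_cong[OF m]) (use f T in \<open>simp_all add: m_def\<close>)
    then show "f \<in> sobolev_W21 T"
      by (rule primitive_on_continuous_imp_sobolev_W21) (rule m')
  qed
  have "energy T B f = (LINT t|?L. (m' t)\<^sup>2 + (m t - B t)\<^sup>2)"
    unfolding energy_def
  proof (rule integral_cong_AE)
    have "AE t in ?L. (f has_real_derivative m' t) (at t)"
      by (rule AE_deriv_primitive_on[OF fprim m'])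
    moreover have "AE t in ?L. t \<in> {0..T}"
      by (intro AE_I2) simp
    ultimately show "AE t in ?L. (deriv f t)\<^sup>2 + \<bar>f t - B t\<bar>\<^sup>2 = (m' t)\<^sup>2 + (m t - B t)\<^sup>2"
      by eventually_elim (simp add: DERIV_imp_deriv f m_def)
    have "square_integrable_on {0..T} (\<lambda>t. f t - B t)"
      using B continuous_on_imp_square_integrable_on[OF primitive_on_continuous[OF fprim]]
      by (intro square_integrable_on_diff)
    moreover have "square_integrable_on {0..T} (deriv f)"
      using \<open>f \<in> sobolev_W21 T\<close> by (simp add: sobolev_W21_def)
    ultimately show "(\<lambda>t. (deriv f t)\<^sup>2 + \<bar>f t - B t\<bar>\<^sup>2) \<in> borel_measurable ?L"
      by (simp add: square_integrable_on_def borel_measurable_integrable)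
  qed (use int(1) in auto)
  moreover have "energy T B u = (LINT t|?L. ((m' t)\<^sup>2 + (m t - B t)\<^sup>2) +
      2 * (p t * m' t + (m t - B t) * h t) + ((p t)\<^sup>2 + (h t)\<^sup>2))"
    unfolding energy_def
    by (rule Bochner_Integration.integral_cong[OF refl])
       (simp add: p_def h_def power2_eq_square algebra_simps)
  moreover have "\<dots> = (LINT t|?L. (m' t)\<^sup>2 + (m t - B t)\<^sup>2) +
      2 * (LINT t|?L. p t * m' t + (m t - B t) * h t) + (LINT t|?L. (p t)\<^sup>2 + (h t)\<^sup>2)"
    by (simp only: Bochner_Integration.integral_add integral_mult_right_zero
        Bochner_Integration.integrable_add integrable_mult_right int cross)
  ultimately have "energy T B u = energy T B f + (LINT t|?L. (p t)\<^sup>2 + (h t)\<^sup>2)"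
    using first_variation_minimizer[OF T B1 h, folded m_def m'_def] by simp
  then show "energy T B u = energy T B f +
      (LINT t|?L. (deriv u t - minimizer_deriv T B t)\<^sup>2 + (u t - minimizer T B t)\<^sup>2)"
    by (simp add: p_def h_def m_def m'_def)
qed

theorem proposition2p3:
  fixes T :: real and B :: "real \<Rightarrow> real"
  assumes "T > 0" and "square_integrable_on {0..T} B"
  shows "(\<forall>f. is_solution T B f \<longleftrightarrow>
            (\<forall>t\<in>{0..T}. f t =
               - (LINT s|lebesgue_on {0..t}. B s * sinh (t - s))
               + (LINT s|lebesgue_on {0..T}. B s * cosh (T - s)) / (exp T - exp (- T))
                   * (exp t + exp (- t)))) \<and>
         (\<forall>f. is_solution T B f \<longrightarrow>
            (\<forall>t\<in>{0<..<T}.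
               (f has_real_derivative
                 - (LINT s|lebesgue_on {0..t}. B s * cosh (t - s))
                 + (LINT s|lebesgue_on {0..T}. B s * cosh (T - s)) / (exp T - exp (- T))
                     * (exp t - exp (- t))) (at t)))"
proof -
  note B1 = square_integrable_on_imp_integrable[OF assms(2)]
  note euler_lagrange = minimizer_euler_lagrange[OF assms(1) B1]
  let ?m = "minimizer T B" and ?m' = "minimizer_deriv T B"
  have m': "continuous_on {0..T} ?m'"
    by (rule primitive_on_continuous[OF euler_lagrange(2)])
  have prim: "primitive_on 0 T ?m' f" if "\<forall>t\<in>{0..T}. f t = ?m t" for f
    by (rule primitive_on_cong[OF euler_lagrange(1)]) (use that assms(1) in auto)
  have sobolev: "f \<in> sobolev_W21 T" if "\<forall>t\<in>{0..T}. f t = ?m t" for f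
    by (rule primitive_on_continuous_imp_sobolev_W21[OF prim[OF that] m'])
  have solution: "is_solution T B f \<longleftrightarrow> (\<forall>t\<in>{0..T}. f t = ?m t)" for f
  proof
    assume f: "is_solution T B f"
    then have fW: "f \<in> sobolev_W21 T" and "energy T B f \<le> energy T B ?m"
      using sobolev[of ?m] by (auto simp: is_solution_def)
    note excess = energy_eq_energy_minimizer_plus[OF assms fW, of ?m, OF refl]
    let ?h = "\<lambda>t. f t - ?m t" and ?p = "\<lambda>t. deriv f t - ?m' t"
    have h2: "continuous_on {0..T} (\<lambda>t. (?h t)\<^sup>2)"
      using excess(3) by (rule continuous_on_power)
    then have "(LINT t|lebesgue_on {0..T}. (?h t)\<^sup>2) \<le> (LINT t|lebesgue_on {0..T}. (?p t)\<^sup>2 + (?h t)\<^sup>2)"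
      using excess(2) by (intro integral_mono) (auto intro: continuous_imp_integrable_real)
    also have "\<dots> \<le> 0"
      using excess(1) \<open>energy T B f \<le> energy T B ?m\<close> by simp
    finally have "(LINT t|lebesgue_on {0..T}. (?h t)\<^sup>2) = 0"
      by (intro antisym Bochner_Integration.integral_nonneg) auto
    then show "\<forall>t\<in>{0..T}. f t = ?m t"
      using integralL_eq_0_iff[OF h2 assms(1)] by simp
  next
    assume f: "\<forall>t\<in>{0..T}. f t = ?m t"
    have "energy T B f \<le> energy T B g" if "g \<in> sobolev_W21 T" for g
      using energy_eq_energy_minimizer_plus(1)[OF assms that, of f] f
      by (simp add: Bochner_Integration.integral_nonneg)
    then show "is_solution T B f"
      using sobolev[OF f] by (simp add: is_solution_def)
  qed
  moreover have "(f has_real_derivative ?m' t) (at t)" if "is_solution T B f" "t \<in> {0<..<T}" for f t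
    using primitive_on_has_real_derivative[OF prim m'] solution that by blast
  ultimately show ?thesis
    unfolding minimizer_def minimizer_deriv_def by blast
qed

end
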